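(* Fix a subcarrier $n$ and a set $\mathcal U'_n\subseteq\{1,\dots,K\}$ of $M$ active users. The precomputation of algorithm i-SCPC has complexity $O(M^2)$, and any subsequent evaluation i-SCPC$(\bar P^n)$ with $\bar P^n\le P_{max}$ costs $O(M)$. Hence, for $C$ different power budgets (each at most $P_{max}$), i-SCPC computes their respective optimal single-carrier power controls, i.e. an optimal solution of the problem $\mathcal P'_{SCPC}(n)$ for each budget, with overall complexity $O(M^2+CM)$.
   Context: Setting. $K\ge 1$ users, a subcarrier $n$ with bandwidth $W_n>0$, weights $w_1,\dots,w_K>0$, normalized noise powers $\tilde\eta^n_k>0$ ($k=1,\dots,K$), and a permutation $\pi_n$ of $\{1,\dots,K\}$ with $\tilde\eta^n_{\pi_n(1)}\ge\dots\ge\tilde\eta^n_{\pi_n(K)}$. For $1\le j\le i\le K$ define $$f^n_{j,i}(x)=\begin{cases}W_n w_{\pi_n(i)}\log_2(x+\tilde\eta^n_{\pi_n(i)}) & j=1,\\ W_n\left[w_{\pi_n(i)}\log_2(x+\tilde\eta^n_{\pi_n(i)})-w_{\pi_n(j-1)}\log_2(x+\tilde\eta^n_{\pi_n(j-1)})\right] & j>1.\end{cases}$$ Active users. Write $\mathcal U'_n=\{1_n<2_n<\dots<|\mathcal U'_n|_n\}$ and $0_n=0$, and set $\tilde f^n_{j,i}(\mathcal U'_n,x)=f^n_{(j-1)_n+1,\,i_n}(x)$ for $1\le j\le i\le|\mathcal U'_n|$. Problem $\mathcal P'_{SCPC}(n)$ with budget $\bar P^n\ge 0$: maximize $\sum_{i=1}^{|\mathcal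 U'_n|}\tilde f^n_{i,i}(\mathcal U'_n,x^n_{i_n})+B^n$ over $(x^n_{1_n},\dots,x^n_{|\mathcal U'_n|_n})$ subject to $\bar P^n\ge x^n_{1_n}\ge\dots\ge x^n_{|\mathcal U'_n|_n}\ge 0$, where $B^n$ is a constant independent of the variables and of $\bar P^n$. Argmax. For $1\le j\le i\le K$, with $a=\pi_n(i)$ and (if $j>1$) $b=\pi_n(j-1)$: $\mathrm{Argmax}f(j,i,\bar P^n)=\bar P^n$ if $j=1$ or $w_a\ge w_b$, and otherwise $\max\{0,\min\{\frac{w_b\tilde\eta^n_a-w_a\tilde\eta^n_b}{w_a-w_b},\bar P^n\}\}$. Set $\mathrm{Argmax}\tilde f(j,i,\bar P^n)=\mathrm{Argmax}f((j-1)_n+1,i_n,\bar P^n)$. Algorithm SCPC$(\mathcal U'_n,\bar P^n)$: for $i=1,\dots,|\mathcal U'_n|$: set $x^*\leftarrow\mathrm{Argmax}\tilde f(i,i,\bar P^n)$ and $j\leftarrow i-1$; while $j\ge1$ and $x^n_{j_n}<x^*$, set $x^*\leftarrow\mathrm{Argmax}\tilde f(j,i,\bar P^n)$ and $j\leftarrow j-1$; then set $x^n_{(j+1)_n},\dots,x^n_{i_n}\leftarrow x^*$. Return $x^n_{1_n},\dots,x^n_{|\mathcal U'_n|_n}$. Algorithm i-SCPC: given $P_{max}$, the precomputation stores $(x^n_{1_n},\dots,x^n_{|\mathcal U'_n|_n})=$ SCPC$(\mathcal U'_n,P_{max})$. An evaluation i-SCPC$(\bar P^n)$, $\bar P^n\le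 P_{max}$, returns $\min\{x^n_{1_n},\bar P^n\},\dots,\min\{x^n_{|\mathcal U'_n|_n},\bar P^n\}$. Complexity is the worst-case number of basic operations (real arithmetic, comparisons); one evaluation of $f^n_{j,i}$ or of $\mathrm{Argmax}f$ costs $O(1)$. *)

theory Defs
  imports "HOL-Analysis.Analysis" "HOL-Library.Monad_Syntax"
begin

text \<open>Users are \<open>1, \<dots>, num_users S\<close>; \<open>noise\<close> is the normalized noise power, and \<open>decode\<close> the
  permutation \<open>\<pi>\<close> that lists the users by decreasing noise, so that the indices \<open>i, j\<close> below are
  positions in this order.\<close>

record subcarrier =
  num_users :: nat
  bandwidth :: real
  weight :: "nat \<Rightarrow> real"
  noise :: "nat \<Rightarrow> real"
  decode :: "nat \<Rightarrow> nat"

definition valid_subcarrier :: "subcarrier \<Rightarrow> bool" where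
  "valid_subcarrier S \<longleftrightarrow>
     1 \<le> num_users S \<and> 0 < bandwidth S \<and>
     (\<forall>k\<in>{1..num_users S}. 0 < weight S k \<and> 0 < noise S k) \<and>
     decode S permutes {1..num_users S} \<and>
     (\<forall>i j. 1 \<le> i \<and> i \<le> j \<and> j \<le> num_users S \<longrightarrow> noise S (decode S i) \<ge> noise S (decode S j))"

definition rate_f :: "subcarrier \<Rightarrow> nat \<Rightarrow> nat \<Rightarrow> real \<Rightarrow> real" where
  "rate_f S j i x =
     (if j = 1
      then bandwidth S * weight S (decode S i) * log 2 (x + noise S (decode S i))
      else bandwidth S *
             (weight S (decode S i) * log 2 (x + noise S (decode S i)) -
              weight S (decode S (j - 1)) * log 2 (x + noise S (decode S (j - 1)))))"

text \<open>The set of active users \<open>U\<close> consists of positions in the order of \<open>decode\<close>.\<close>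

definition active :: "nat set \<Rightarrow> nat \<Rightarrow> nat" where
  "active U i = (if i = 0 then 0 else sorted_list_of_set U ! (i - 1))"

definition active_f :: "subcarrier \<Rightarrow> nat set \<Rightarrow> nat \<Rightarrow> nat \<Rightarrow> real \<Rightarrow> real" where
  "active_f S U j i x = rate_f S (active U (j - 1) + 1) (active U i) x"

text \<open>A vector of variables is a function on the indices \<open>{1..num_users S}\<close>; only its values on
  the active users \<open>U\<close> matter.\<close>

definition objective :: "subcarrier \<Rightarrow> nat set \<Rightarrow> real \<Rightarrow> (nat \<Rightarrow> real) \<Rightarrow> real" where
  "objective S U B x = (\<Sum>i = 1..card U. active_f S U i i (x (active U i))) + B"

definition feasible :: "nat set \<Rightarrow> real \<Rightarrow> (nat \<Rightarrow> real) \<Rightarrow> bool" where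
  "feasible U P x \<longleftrightarrow> sorted_wrt (\<ge>) (P # map (\<lambda>i. x (active U i)) [1..<Suc (card U)] @ [0])"

definition optimal_control ::
    "subcarrier \<Rightarrow> nat set \<Rightarrow> real \<Rightarrow> real \<Rightarrow> (nat \<Rightarrow> real) \<Rightarrow> bool" where
  "optimal_control S U B P x \<longleftrightarrow> is_arg_max (objective S U B) (feasible U P) x"

definition argmax_f :: "subcarrier \<Rightarrow> nat \<Rightarrow> nat \<Rightarrow> real \<Rightarrow> real" where
  "argmax_f S j i P =
     (let a = decode S i; b = decode S (j - 1) in
      if j = 1 \<or> weight S a \<ge> weight S b then P
      else max 0 (min ((weight S b * noise S a - weight S a * noise S b) /
                       (weight S a - weight S b)) P))"

definition active_argmax :: "subcarrier \<Rightarrow> nat set \<Rightarrow> nat \<Rightarrow> nat \<Rightarrow> real \<Rightarrow> real" where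
  "active_argmax S U j i P = argmax_f S (active U (j - 1) + 1) (active U i) P"

text \<open>A computation yields a result together with the number of basic operations performed.
  \<open>basic v\<close> is to be used only when \<open>v\<close> is the outcome of a single operation on already computed
  values: an arithmetic operation, a comparison, a minimum, or reading or writing one cell of an array.
  Counting also index arithmetic, loop tests and memory accesses only increases the count.
  Arrays are functions, updated by \<open>x(u := v)\<close>; the active users are available as a sorted array,
  so that \<open>active U i\<close> is a single array access.\<close>

datatype 'a timed = Timed (result: 'a) (cost: nat)

definition ret :: "'a \<Rightarrow> 'a timed" where
  "ret v = Timed v 0"

definition basic :: "'a \<Rightarrow> 'a timed" where
  "basic v = Timed v 1"

definition bind_timed :: "'a timed \<Rightarrow> ('a \<Rightarrow> 'b timed) \<Rightarrow> 'b timed" where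
  "bind_timed m f = Timed (result (f (result m))) (cost m + cost (f (result m)))"

adhoc_overloading Monad_Syntax.bind \<rightleftharpoons> bind_timed

lemma bind_timed_cong [fundef_cong]:
  assumes "m = m'" and "f (result m') = f' (result m')"
  shows "bind_timed m f = bind_timed m' f'"
  using assms by (simp add: bind_timed_def)

text \<open>\<open>for_loop k n body s\<close> runs \<open>body\<close> for \<open>k, \<dots>, n\<close>, threading the state \<open>s\<close>.\<close>

function for_loop :: "nat \<Rightarrow> nat \<Rightarrow> (nat \<Rightarrow> 's \<Rightarrow> 's timed) \<Rightarrow> 's \<Rightarrow> 's timed" where
  "for_loop k n body s = do {
     b \<leftarrow> basic (k \<le> n);
     if b then do {
       s' \<leftarrow> body k s;
       k' \<leftarrow> basic (k + 1);
       for_loop k' n body s'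
     } else ret s
   }"
  by auto
termination
  by (relation "Wellfounded.measure (\<lambda>(k, n, _, _). Suc n - k)") (auto simp: basic_def)

declare for_loop.simps [simp del]

text \<open>The parameter \<open>\<kappa>\<close> is the cost of one evaluation of the argmax function.\<close>

definition eval_argmax ::
    "nat \<Rightarrow> subcarrier \<Rightarrow> nat set \<Rightarrow> nat \<Rightarrow> nat \<Rightarrow> real \<Rightarrow> real timed" where
  "eval_argmax \<kappa> S U j i P = Timed (active_argmax S U j i P) \<kappa>"

function scpc_while ::
    "nat \<Rightarrow> subcarrier \<Rightarrow> nat set \<Rightarrow> real \<Rightarrow> (nat \<Rightarrow> real) \<Rightarrow> nat \<Rightarrow> nat \<Rightarrow> real \<Rightarrow> (nat \<times> real) timed"
  where
  "scpc_while \<kappa> S U P x i j xstar = do {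
     b \<leftarrow> basic (j \<ge> 1);
     if \<not> b then ret (j, xstar)
     else do {
       u \<leftarrow> basic (active U j);
       v \<leftarrow> basic (x u);
       c \<leftarrow> basic (v < xstar);
       if \<not> c then ret (j, xstar)
       else do {
         xstar' \<leftarrow> eval_argmax \<kappa> S U j i P;
         j' \<leftarrow> basic (j - 1);
         scpc_while \<kappa> S U P x i j' xstar'
       }
     }
   }"
  by auto
termination
  by (relation "Wellfounded.measure (\<lambda>(_, _, _, _, _, _, j, _). j)") (auto simp: basic_def)

declare scpc_while.simps [simp del]

definition scpc :: "nat \<Rightarrow> subcarrier \<Rightarrow> nat set \<Rightarrow> real \<Rightarrow> (nat \<Rightarrow> real) timed" where
  "scpc \<kappa> S U P =
     for_loop 1 (card U)
       (\<lambda>i x. do {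
          xstar \<leftarrow> eval_argmax \<kappa> S U i i P;
          j \<leftarrow> basic (i - 1);
          (j', xstar') \<leftarrow> scpc_while \<kappa> S U P x i j xstar;
          l \<leftarrow> basic (j' + 1);
          for_loop l i (\<lambda>k y. do { u \<leftarrow> basic (active U k); basic (y(u := xstar')) }) x
        })
       (\<lambda>_. 0)"

definition iscpc_precompute :: "nat \<Rightarrow> subcarrier \<Rightarrow> nat set \<Rightarrow> real \<Rightarrow> (nat \<Rightarrow> real) timed" where
  "iscpc_precompute \<kappa> S U Pmax = scpc \<kappa> S U Pmax"

definition iscpc_eval :: "nat set \<Rightarrow> (nat \<Rightarrow> real) \<Rightarrow> real \<Rightarrow> (nat \<Rightarrow> real) timed" where
  "iscpc_eval U x P =
     for_loop 1 (card U)
       (\<lambda>i y. do {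
          u \<leftarrow> basic (active U i);
          v \<leftarrow> basic (x u);
          m \<leftarrow> basic (min v P);
          basic (y(u := m))
        })
       (\<lambda>_. 0)"

text \<open>One precomputation followed by one evaluation for each of the budgets
  \<open>Ps 1, \<dots>, Ps C\<close>; entry \<open>r\<close> of the result is (a reference to) the vector for \<open>Ps r\<close>.\<close>

definition iscpc_all ::
    "nat \<Rightarrow> subcarrier \<Rightarrow> nat set \<Rightarrow> real \<Rightarrow> nat \<Rightarrow> (nat \<Rightarrow> real) \<Rightarrow> (nat \<Rightarrow> nat \<Rightarrow> real) timed" where
  "iscpc_all \<kappa> S U Pmax C Ps = do {
     x \<leftarrow> iscpc_precompute \<kappa> S U Pmax;
     for_loop 1 C
       (\<lambda>r R. do {
          P \<leftarrow> basic (Ps r);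
          y \<leftarrow> iscpc_eval U x P;
          basic (R(r := y))
        })
       (\<lambda>_ _. 0)
   }"

end

theory Submission
  imports Defs
begin

text \<open>
  The complexity bounds come from counting loop iterations: the while loop in round \<open>i\<close> runs at
  most \<open>i - 1\<close> times, and the final loop of the round writes at most \<open>i\<close> cells.

  For optimality, let \<open>g\<^sub>k\<close> be the rate \<open>W w log\<^sub>2 (x + \<eta>)\<close> of the \<open>k\<close>-th active user, with
  \<open>g\<^sub>0 = 0\<close>, and let \<open>D\<^sub>k\<close> be its derivative. Since the summand of index \<open>k\<close> in the objective is
  \<open>g\<^sub>k - g\<^bsub>k-1\<^esub>\<close>, telescoping gives for every nonincreasing vector \<open>x\<close> with entries in \<open>[0, P]\<close>

    objective \<open>x\<close> = objective \<open>0 + \<integral>\<^sub>0\<^sup>P D\<^bsub>m(t)\<^esub>(t) dt\<close>, where \<open>m(t) = |{k. x\<^sub>k > t}|\<close>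

  (\<open>objective_integral\<close> and \<open>sum_marginal_prefix\<close>). Hence \<open>x\<close> is optimal as soon as, at every power
  level \<open>t < P\<close>, the index \<open>m(t)\<close> maximizes \<open>D\<^bsub>m\<^esub>(t)\<close> over all \<open>m\<close>. This pointwise condition is
  inherited by the truncation of \<open>x\<close> to a smaller budget, which does not affect the levels below
  that budget; this is why one precomputation serves all budgets (\<open>optimal_control_truncation\<close>).

  The argmax function compares marginal rates: for \<open>b < a\<close>, the level \<open>t\<close> lies below the argmax of
  \<open>g\<^sub>a - g\<^sub>b\<close> exactly when \<open>a\<close> is preferred to \<open>b\<close> at \<open>t\<close>, in a suitable strict total order on the
  indices that refines the comparison of the \<open>D\<^sub>k(t)\<close> (\<open>less_active_argmax_iff\<close>). The invariant of
  the precomputation is that after round \<open>i\<close>, at every level \<open>t\<close>, the number of entries above \<open>t\<close>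
  is the most preferred index among \<open>0, \<dots>, i\<close>. In the next round that index either
  stays or becomes \<open>i + 1\<close>, and the while loop finds the levels at which it changes
  (\<open>scpc_while_spec\<close>, \<open>level_optimal_extend\<close>).
\<close>

section \<open>Loops and their costs\<close>

lemma timed_simps [simp]:
  "result (ret v) = v" "cost (ret v) = 0"
  "result (basic v) = v" "cost (basic v) = 1"
  "result (bind_timed m f) = result (f (result m))"
  "cost (bind_timed m f) = cost m + cost (f (result m))"
  "result (eval_argmax \<kappa> S U j i P) = active_argmax S U j i P"
  "cost (eval_argmax \<kappa> S U j i P) = \<kappa>"
  by (simp_all add: ret_def basic_def bind_timed_def eval_argmax_def)

lemma for_loop_invariant:
  assumes "k \<le> n + 1" and "Inv k s"
    and "\<And>j s. k \<le> j \<Longrightarrow> j \<le> n \<Longrightarrow> Inv j s \<Longrightarrow> Inv (j + 1) (result (body j s))"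
  shows "Inv (n + 1) (result (for_loop k n body s))"
  using assms
proof (induction "n + 1 - k" arbitrary: k s)
  case 0
  then show ?case by (subst for_loop.simps) simp
next
  case (Suc d)
  have "Inv (n + 1) (result (for_loop (k + 1) n body (result (body k s))))"
    using Suc.hyps(2) Suc.prems by (intro Suc.hyps(1)) auto
  moreover have "k \<le> n"
    using Suc.hyps(2) by simp
  ultimately show ?case
    by (subst for_loop.simps) simp
qed

lemma cost_for_loop_le:
  assumes "\<And>j s. k \<le> j \<Longrightarrow> j \<le> n \<Longrightarrow> cost (body j s) \<le> c"
  shows "cost (for_loop k n body s) \<le> (n + 1 - k) * (c + 2) + 1"
  using assms
proof (induction "n + 1 - k" arbitrary: k s)
  case 0
  then show ?case by (subst for_loop.simps) simp
next
  case (Suc d)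
  have d: "n + 1 - k = Suc d" "n + 1 - (k + 1) = d" and "k \<le> n"
    using Suc.hyps(2) by auto
  have "cost (for_loop (k + 1) n body (result (body k s))) \<le> (n + 1 - (k + 1)) * (c + 2) + 1"
    using d Suc.prems by (intro Suc.hyps(1)) auto
  moreover have "cost (body k s) \<le> c"
    using \<open>k \<le> n\<close> by (intro Suc.prems) auto
  ultimately show ?case
    unfolding d using \<open>k \<le> n\<close> by (subst for_loop.simps) simp
qed

lemma cost_scpc_while_le:
  "cost (scpc_while \<kappa> S U P x i j xstar) \<le> (\<kappa> + 5) * j + 4"
proof (induction j arbitrary: xstar)
  case 0
  then show ?case by (subst scpc_while.simps) simp
next
  case (Suc j)
  show ?case
    using Suc.IH[of "active_argmax S U (Suc j) i P"] by (subst scpc_while.simps) simp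
qed

lemma cost_iscpc_precompute_le:
  assumes "1 \<le> card U"
  shows "cost (iscpc_precompute \<kappa> S U P) \<le> (2 * \<kappa> + 19) * (card U)\<^sup>2"
proof -
  let ?M = "card U"
  let ?c = "(2 * \<kappa> + 16) * ?M"
  \<comment> \<open>The \<open>\<kappa>\<close> of the first argmax evaluation and the additive constants are absorbed into
    multiples of \<open>?M \<ge> 1\<close>.\<close>
  have body: "cost (do {
          xstar \<leftarrow> eval_argmax \<kappa> S U i i P;
          j \<leftarrow> basic (i - 1);
          (j', xstar') \<leftarrow> scpc_while \<kappa> S U P x i j xstar;
          l \<leftarrow> basic (j' + 1);
          for_loop l i (\<lambda>k y. do { u \<leftarrow> basic (active U k); basic (y(u := xstar')) }) x
        }) \<le> ?c"
    if "1 \<le> i" "i \<le> ?M" for i x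
  proof -
    have fill: "cost (for_loop (Suc j') i
        (\<lambda>k y. do { u \<leftarrow> basic (active U k); basic (y(u := v)) }) x) \<le> 4 * i + 1" for j' v
    proof -
      have "cost (for_loop (Suc j') i
        (\<lambda>k y. do { u \<leftarrow> basic (active U k); basic (y(u := v)) }) x)
        \<le> (i + 1 - Suc j') * (2 + 2) + 1"
        by (rule cost_for_loop_le) simp
      then show ?thesis by simp
    qed
    have "cost (scpc_while \<kappa> S U P x i (i - 1) (active_argmax S U i i P))
        \<le> (\<kappa> + 5) * (i - 1) + 4"
      by (rule cost_scpc_while_le)
    also have "\<dots> \<le> (\<kappa> + 5) * ?M + 4"
      using that by (intro add_mono mult_mono) auto
    finally have while_le: "cost (scpc_while \<kappa> S U P x i (i - 1) (active_argmax S U i i P))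
        \<le> (\<kappa> + 5) * ?M + 4" .
    have "cost (do {
          xstar \<leftarrow> eval_argmax \<kappa> S U i i P;
          j \<leftarrow> basic (i - 1);
          (j', xstar') \<leftarrow> scpc_while \<kappa> S U P x i j xstar;
          l \<leftarrow> basic (j' + 1);
          for_loop l i (\<lambda>k y. do { u \<leftarrow> basic (active U k); basic (y(u := xstar')) }) x
        }) \<le> \<kappa> + (\<kappa> + 5) * ?M + 4 * i + 7"
      using while_le fill[of "fst (result (scpc_while \<kappa> S U P x i (i - 1) (active_argmax S U i i P)))"
          "snd (result (scpc_while \<kappa> S U P x i (i - 1) (active_argmax S U i i P)))"]
      by (simp add: case_prod_beta)
    also have "\<dots> \<le> \<kappa> * ?M + (\<kappa> + 5) * ?M + 4 * ?M + 7 * ?M"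
      using assms that by (intro add_mono) auto
    finally show ?thesis
      by (simp add: algebra_simps)
  qed
  have "cost (iscpc_precompute \<kappa> S U P) \<le> (?M + 1 - 1) * (?c + 2) + 1"
    unfolding iscpc_precompute_def scpc_def by (intro cost_for_loop_le body)
  also have "\<dots> = (2 * \<kappa> + 16) * ?M\<^sup>2 + 2 * ?M + 1"
    by (simp add: algebra_simps power2_eq_square)
  also have "\<dots> \<le> (2 * \<kappa> + 16) * ?M\<^sup>2 + 2 * ?M\<^sup>2 + ?M\<^sup>2"
    using assms by (intro add_mono) (auto simp: power2_eq_square)
  finally show ?thesis
    by (simp add: algebra_simps)
qed

lemma cost_iscpc_eval_le:
  assumes "1 \<le> card U"
  shows "cost (iscpc_eval U x P) \<le> 7 * card U"
proof -
  have "cost (iscpc_eval U x P) \<le> (card U + 1 - 1) * (4 + 2) + 1"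
    unfolding iscpc_eval_def by (intro cost_for_loop_le) simp
  then show ?thesis
    using assms by simp
qed

lemma cost_iscpc_all_le:
  assumes "1 \<le> card U"
  shows "cost (iscpc_all \<kappa> S U Pmax C Ps) \<le> (2 * \<kappa> + 20) * ((card U)\<^sup>2 + C * card U)"
proof -
  let ?M = "card U"
  have "cost (for_loop 1 C (\<lambda>r R. do {
          P \<leftarrow> basic (Ps r);
          y \<leftarrow> iscpc_eval U x P;
          basic (R(r := y))
        }) (\<lambda>_ _. 0)) \<le> (C + 1 - 1) * (7 * ?M + 2 + 2) + 1" for x
    using cost_iscpc_eval_le[OF assms] by (intro cost_for_loop_le) simp
  then have "cost (iscpc_all \<kappa> S U Pmax C Ps)
      \<le> (2 * \<kappa> + 19) * ?M\<^sup>2 + ((C + 1 - 1) * (7 * ?M + 2 + 2) + 1)"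
    using cost_iscpc_precompute_le[OF assms, of \<kappa> S Pmax]
    unfolding iscpc_all_def timed_simps by (intro add_mono) auto
  also have "\<dots> = (2 * \<kappa> + 19) * ?M\<^sup>2 + (7 * (C * ?M) + 4 * C) + 1"
    by (simp add: algebra_simps)
  also have "\<dots> \<le> (2 * \<kappa> + 19) * ?M\<^sup>2 + (7 * (C * ?M) + 4 * (C * ?M)) + ?M\<^sup>2"
    using assms by (intro add_mono) auto
  also have "\<dots> \<le> (2 * \<kappa> + 20) * (?M\<^sup>2 + C * ?M)"
    by (simp add: algebra_simps)
  finally show ?thesis .
qed

section \<open>The active users\<close>

lemma active_0 [simp]: "active U 0 = 0"
  by (simp add: active_def)

lemma active_in:
  assumes "finite U" "1 \<le> k" "k \<le> card U"
  shows "active U k \<in> U"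
proof -
  have "sorted_list_of_set U ! (k - 1) \<in> set (sorted_list_of_set U)"
    using assms by (intro nth_mem) auto
  then show ?thesis
    using assms by (simp add: active_def)
qed

lemma active_strict_mono:
  assumes "finite U" "0 \<notin> U" "k < l" "l \<le> card U"
  shows "active U k < active U l"
proof (cases "k = 0")
  case True
  have "active U l \<in> U"
    using assms by (intro active_in) auto
  then show ?thesis
    using True assms(2) by (cases "active U l") auto
next
  case False
  then show ?thesis
    using assms strict_sorted_list_of_set[of U]
    by (auto simp: active_def sorted_wrt_iff_nth_less)
qed

lemma active_eq_iff:
  assumes "finite U" "0 \<notin> U" "k \<le> card U" "l \<le> card U"
  shows "active U k = active U l \<longleftrightarrow> k = l"
  using active_strict_mono[OF assms(1,2), of k l] active_strict_mono[OF assms(1,2), of l k] assms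
  by (metis less_irrefl nat_neq_iff)

text \<open>The loop at the end of a round assigns \<open>v\<close> to the active users \<open>j + 1, \<dots>, i\<close>. The cell at
  index \<open>k = 0\<close>, which stands for no user, is also unchanged.\<close>

lemma result_fill_loop:
  assumes "finite U" "0 \<notin> U" "j \<le> i" "i \<le> card U" "k \<le> card U"
  shows "result (for_loop (j + 1) i (\<lambda>k y. do { u \<leftarrow> basic (active U k); basic (y(u := v)) }) x)
    (active U k) = (if j < k \<and> k \<le> i then v else x (active U k))"
proof -
  define Inv where "Inv = (\<lambda>n (y :: nat \<Rightarrow> 'a). \<forall>k\<le>card U.
    y (active U k) = (if j < k \<and> k < n then v else x (active U k)))"
  have "Inv (i + 1)
    (result (for_loop (j + 1) i (\<lambda>k y. do { u \<leftarrow> basic (active U k); basic (y(u := v)) }) x))"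
    by (rule for_loop_invariant[where Inv = Inv])
      (use assms in \<open>auto simp: Inv_def active_eq_iff less_Suc_eq\<close>)
  then show ?thesis
    using assms by (simp add: Inv_def less_Suc_eq_le)
qed

lemma result_iscpc_eval:
  assumes "finite U" "0 \<notin> U" "1 \<le> k" "k \<le> card U"
  shows "result (iscpc_eval U x P) (active U k) = min (x (active U k)) P"
proof -
  define Inv where "Inv = (\<lambda>n y. \<forall>k. 1 \<le> k \<and> k < n \<and> k \<le> card U \<longrightarrow>
    y (active U k) = min (x (active U k)) P)"
  have "Inv (card U + 1) (result (iscpc_eval U x P))"
    unfolding iscpc_eval_def
    by (rule for_loop_invariant[where Inv = Inv])
      (use assms in \<open>auto simp: Inv_def active_eq_iff less_Suc_eq\<close>)
  then show ?thesis
    using assms by (simp add: Inv_def)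
qed

lemma result_iscpc_all:
  assumes "1 \<le> r" "r \<le> C"
  shows "result (iscpc_all \<kappa> S U Pmax C Ps) r
    = result (iscpc_eval U (result (iscpc_precompute \<kappa> S U Pmax)) (Ps r))"
proof -
  let ?x = "result (iscpc_precompute \<kappa> S U Pmax)"
  define Inv where "Inv = (\<lambda>n R. \<forall>r. 1 \<le> r \<and> r < n \<longrightarrow> R r = result (iscpc_eval U ?x (Ps r)))"
  have "Inv (C + 1) (result (iscpc_all \<kappa> S U Pmax C Ps))"
    unfolding iscpc_all_def timed_simps
    by (rule for_loop_invariant[where Inv = Inv]) (auto simp: Inv_def less_Suc_eq)
  then show ?thesis
    using assms by (simp add: Inv_def)
qed

lemma feasible_iff:
  "feasible U P x \<longleftrightarrow> 0 \<le> P \<and> (\<forall>k\<in>{1..card U}. 0 \<le> x (active U k) \<and> x (active U k) \<le> P) \<and>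
     (\<forall>k l. 1 \<le> k \<and> k < l \<and> l \<le> card U \<longrightarrow> x (active U l) \<le> x (active U k))"
proof -
  have "sorted_wrt (\<ge>) (map (\<lambda>i. x (active U i)) [1..<Suc (card U)]) \<longleftrightarrow>
     (\<forall>k l. 1 \<le> k \<and> k < l \<and> l \<le> card U \<longrightarrow> x (active U l) \<le> x (active U k))" (is "?A \<longleftrightarrow> ?B")
  proof
    assume ?A
    show ?B
    proof (intro allI impI)
      fix k l assume kl: "1 \<le> k \<and> k < l \<and> l \<le> card U"
      have "\<forall>i j. i < j \<longrightarrow> j < card U \<longrightarrow> x (active U (Suc j)) \<le> x (active U (Suc i))"
        using \<open>?A\<close> by (simp add: sorted_wrt_iff_nth_less del: upt_Suc)
      from this[rule_format, of "k - 1" "l - 1"] show "x (active U l) \<le> x (active U k)"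
        using kl by (cases k; cases l) auto
    qed
  next
    assume ?B
    then show ?A
      by (simp add: sorted_wrt_iff_nth_less del: upt_Suc)
  qed
  then show ?thesis
    by (auto simp: feasible_def sorted_wrt_append simp del: upt_Suc)
qed

section \<open>Marginal rates\<close>

text \<open>The rate \<open>g\<^sub>k\<close> of the \<open>k\<close>-th active user, without the contribution of the user before it;
  index \<open>0\<close> stands for no user and has rate \<open>0\<close>.\<close>

definition rate_level :: "subcarrier \<Rightarrow> nat set \<Rightarrow> nat \<Rightarrow> real \<Rightarrow> real" where
  "rate_level S U k t = (if k = 0 then 0 else
     bandwidth S * weight S (decode S (active U k)) * log 2 (t + noise S (decode S (active U k))))"

text \<open>The derivative \<open>D\<^sub>k\<close> of \<open>g\<^sub>k\<close>.\<close>

definition marginal :: "subcarrier \<Rightarrow> nat set \<Rightarrow> nat \<Rightarrow> real \<Rightarrow> real" where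
  "marginal S U k t = (if k = 0 then 0 else
     bandwidth S / ln 2 *
       (weight S (decode S (active U k)) / (t + noise S (decode S (active U k)))))"

text \<open>The weight of the \<open>k\<close>-th active user, with \<open>0\<close> for the index \<open>0\<close>.\<close>

definition active_weight :: "subcarrier \<Rightarrow> nat set \<Rightarrow> nat \<Rightarrow> real" where
  "active_weight S U k = (if k = 0 then 0 else weight S (decode S (active U k)))"

text \<open>Index \<open>a\<close> is preferred to \<open>b\<close> at level \<open>t\<close>. Ties between marginal rates are broken as the
  argmax function breaks them. If \<open>b < a\<close> and \<open>a\<close> has the smaller weight, a tie at \<open>t\<close> means that
  \<open>t\<close> is the stationary point of \<open>g\<^sub>a - g\<^sub>b\<close>, beyond which \<open>b\<close> is better, so \<open>b\<close> wins; for
  equal weights the argmax is the whole budget, so the later index \<open>a\<close> wins.\<close>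

definition outranked :: "subcarrier \<Rightarrow> nat set \<Rightarrow> real \<Rightarrow> nat \<Rightarrow> nat \<Rightarrow> bool" where
  "outranked S U t b a \<longleftrightarrow> marginal S U b t < marginal S U a t \<or>
     marginal S U b t = marginal S U a t \<and>
       (active_weight S U b < active_weight S U a \<or>
        active_weight S U b = active_weight S U a \<and> b < a)"

lemma outranked_trans:
  "outranked S U t a b \<Longrightarrow> outranked S U t b c \<Longrightarrow> outranked S U t a c"
  by (auto simp: outranked_def)

lemma outranked_irrefl: "\<not> outranked S U t a a"
  by (simp add: outranked_def)

lemma outranked_total: "a \<noteq> b \<Longrightarrow> \<not> outranked S U t a b \<Longrightarrow> outranked S U t b a"
  unfolding outranked_def by linarith

text \<open>A valid subcarrier with a set of active users.\<close>

locale active_subcarrier =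
  fixes S :: subcarrier and U :: "nat set"
  assumes valid: "valid_subcarrier S" and U_subset: "U \<subseteq> {1..num_users S}"
begin

lemma finite_U: "finite U"
  using U_subset finite_subset by blast

lemma zero_notin_U: "0 \<notin> U"
  using U_subset by auto

lemma bandwidth_pos: "0 < bandwidth S"
  using valid by (simp add: valid_subcarrier_def)

lemma
  assumes "1 \<le> k" "k \<le> card U"
  shows weight_pos: "0 < weight S (decode S (active U k))"
    and noise_pos: "0 < noise S (decode S (active U k))"
proof -
  have "active U k \<in> {1..num_users S}"
    using active_in[OF finite_U assms] U_subset by auto
  then have "decode S (active U k) \<in> {1..num_users S}"
    using valid permutes_in_image by (fastforce simp: valid_subcarrier_def)
  then show "0 < weight S (decode S (active U k))" "0 < noise S (decode S (active U k))"
    using valid by (auto simp: valid_subcarrier_def)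
qed

lemma noise_antimono:
  assumes "1 \<le> k" "k < l" "l \<le> card U"
  shows "noise S (decode S (active U l)) \<le> noise S (decode S (active U k))"
proof -
  have "active U k \<in> U" "active U l \<in> U" "active U k < active U l"
    using assms finite_U zero_notin_U by (auto intro: active_in active_strict_mono)
  moreover have "1 \<le> active U k" "active U l \<le> num_users S"
    using calculation U_subset by auto
  ultimately show ?thesis
    using valid unfolding valid_subcarrier_def by (meson less_imp_le)
qed

lemma active_pos: "1 \<le> k \<Longrightarrow> k \<le> card U \<Longrightarrow> 0 < active U k"
  using active_in[OF finite_U] U_subset by fastforce

text \<open>The right-hand side does not depend on the budget \<open>P\<close>. For \<open>b \<ge> 1\<close>, the
  sign of \<open>D\<^sub>a(t) - D\<^sub>b(t)\<close> is that of
  the affine function \<open>w\<^sub>a (t + \<eta>\<^sub>b) - w\<^sub>b (t + \<eta>\<^sub>a)\<close>, whose zero, if the weights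
  differ, is the stationary point in the definition of the argmax.\<close>

lemma less_active_argmax_iff:
  assumes "b < a" "a \<le> card U" "0 \<le> t" "t < P"
  shows "t < active_argmax S U (b + 1) a P \<longleftrightarrow> outranked S U t b a"
proof (cases "b = 0")
  case True
  have "0 < marginal S U a t"
    using assms weight_pos[of a] noise_pos[of a] bandwidth_pos by (auto simp: marginal_def)
  then show ?thesis
    using True assms by (simp add: active_argmax_def argmax_f_def outranked_def marginal_def)
next
  case False
  define wa wb na nb where
    "wa = weight S (decode S (active U a))" and "wb = weight S (decode S (active U b))" and
    "na = noise S (decode S (active U a))" and "nb = noise S (decode S (active U b))"
  note defs = this
  have pos: "0 < wa" "0 < wb" "0 < na" "0 < nb" and "na \<le> nb"
    using False assms noise_antimono[of b a] by (auto simp: defs weight_pos noise_pos)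
  have den: "0 < t + na" "0 < t + nb"
    using pos assms by auto
  have factor: "0 < bandwidth S / ln 2"
    using bandwidth_pos by simp
  have marg: "marginal S U a t = bandwidth S / ln 2 * (wa / (t + na))"
    "marginal S U b t = bandwidth S / ln 2 * (wb / (t + nb))"
    using False assms by (auto simp: marginal_def defs)
  have less: "marginal S U b t < marginal S U a t \<longleftrightarrow> wb * (t + na) < wa * (t + nb)"
    unfolding marg mult_less_cancel_left_pos[OF factor] using den by (simp add: field_simps)
  have eq: "marginal S U b t = marginal S U a t \<longleftrightarrow> wb * (t + na) = wa * (t + nb)"
    unfolding marg using factor den by (subst mult_cancel_left) (auto simp: frac_eq_eq)
  have wts: "active_weight S U a = wa" "active_weight S U b = wb"
    using False assms by (auto simp: active_weight_def defs)
  have arg: "active_argmax S U (Suc b) a P = (if wa \<ge> wb then P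
      else max 0 (min ((wb * na - wa * nb) / (wa - wb)) P))"
    using False assms active_pos[of b]
    by (simp add: active_argmax_def argmax_f_def Let_def defs)
  show ?thesis
  proof (cases "wa \<ge> wb")
    case True
    have "wb * (t + na) \<le> wa * (t + nb)"
      using True \<open>na \<le> nb\<close> den pos by (intro mult_mono) auto
    then show ?thesis
      using True assms by (auto simp: arg outranked_def less eq wts)
  next
    case False
    have "t < active_argmax S U (b + 1) a P \<longleftrightarrow> t < (wb * na - wa * nb) / (wa - wb)"
      using False assms by (auto simp: arg)
    also have "\<dots> \<longleftrightarrow> wb * (t + na) < wa * (t + nb)"
      using False by (simp add: neg_less_divide_eq algebra_simps)
    finally show ?thesis
      using False by (auto simp: outranked_def less wts)
  qed
qed

lemma active_argmax_bounds:
  assumes "0 \<le> P"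
  shows "0 \<le> active_argmax S U j i P" "active_argmax S U j i P \<le> P"
  using assms by (auto simp: active_argmax_def argmax_f_def Let_def)

section \<open>Correctness of the precomputation\<close>

text \<open>The index \<open>m\<close> is the most preferred one among \<open>0, \<dots>, i\<close> at level \<open>t\<close>.\<close>

definition top_rank :: "real \<Rightarrow> nat \<Rightarrow> nat \<Rightarrow> bool" where
  "top_rank t i m \<longleftrightarrow> m \<le> i \<and> (\<forall>l\<le>i. l \<noteq> m \<longrightarrow> outranked S U t l m)"

text \<open>The invariant of the algorithm: the entries of \<open>x\<close> for the first \<open>i\<close> active users lie in
  \<open>[0, P]\<close>, and at each level \<open>t < P\<close> exactly the first \<open>m\<close> of them exceed \<open>t\<close>, where \<open>m\<close> is the most
  preferred index. Monotonicity of the entries is a consequence.\<close>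

definition level_optimal :: "real \<Rightarrow> nat \<Rightarrow> (nat \<Rightarrow> real) \<Rightarrow> bool" where
  "level_optimal P i x \<longleftrightarrow>
     (\<forall>k\<in>{1..i}. 0 \<le> x (active U k) \<and> x (active U k) \<le> P) \<and>
     (\<forall>t. 0 \<le> t \<and> t < P \<longrightarrow> (\<exists>m. top_rank t i m \<and>
        (\<forall>k\<in>{1..i}. t < x (active U k) \<longleftrightarrow> k \<le> m)))"

lemma level_optimal_antimono:
  assumes "level_optimal P i x" "1 \<le> k" "k \<le> l" "l \<le> i"
  shows "x (active U l) \<le> x (active U k)"
proof (rule ccontr)
  assume "\<not> x (active U l) \<le> x (active U k)"
  moreover have "0 \<le> x (active U k)" "x (active U l) \<le> P"
    using assms by (auto simp: level_optimal_def)
  ultimately obtain m where "\<forall>q\<in>{1..i}. x (active U k) < x (active U q) \<longleftrightarrow> q \<le> m"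
    using assms(1) unfolding level_optimal_def by (meson not_le less_le_trans)
  then show False
    using assms \<open>\<not> x (active U l) \<le> x (active U k)\<close>
    by (metis atLeastAtMost_iff le_trans less_irrefl not_le)
qed

text \<open>While round \<open>i\<close> scans downwards, having reached index \<open>j\<close>, the new index \<open>i\<close> is preferred at
  every level whose most preferred index \<open>m\<close> so far exceeds \<open>j\<close> (the assumption \<open>beaten\<close>). The loop
  condition says that \<open>i\<close> is also preferred to \<open>j\<close> at the levels below \<open>x\<^sub>j\<close>, which preserves this
  property.\<close>

lemma scpc_while_spec:
  assumes x: "level_optimal P n x" and i: "i = n + 1" "i \<le> card U"
    and j: "j \<le> n" and xstar: "xstar = active_argmax S U (j + 1) i P"
    and beaten: "\<And>t m. 0 \<le> t \<Longrightarrow> t < P \<Longrightarrow> top_rank t n m \<Longrightarrow> j < m \<Longrightarrow> outranked S U t m i"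
    and res: "result (scpc_while \<kappa> S U P x i j xstar) = (j', v)"
  shows "j' \<le> n \<and> v = active_argmax S U (j' + 1) i P \<and>
    (\<forall>t m. 0 \<le> t \<longrightarrow> t < P \<longrightarrow> top_rank t n m \<longrightarrow> j' < m \<longrightarrow> outranked S U t m i) \<and>
    (j' = 0 \<or> v \<le> x (active U j'))"
  using j xstar beaten res
proof (induction j arbitrary: xstar)
  case 0
  then show ?case by (subst (asm) scpc_while.simps) auto
next
  case (Suc j)
  show ?case
  proof (cases "x (active U (Suc j)) < xstar")
    case False
    then show ?thesis
      using Suc.prems by (subst (asm) scpc_while.simps) auto
  next
    case True
    have step: "outranked S U t m i"
      if t: "0 \<le> t" "t < P" and m: "top_rank t n m" "j < m" for t m
    proof (cases "m = Suc j")
      case True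
      \<comment> \<open>Here \<open>t\<close> is a level below \<open>x\<^bsub>j+1\<^esub>\<close>, hence below \<open>xstar\<close> by the loop condition.\<close>
      obtain m' where m': "top_rank t n m'" "\<forall>k\<in>{1..n}. t < x (active U k) \<longleftrightarrow> k \<le> m'"
        using x t by (auto simp: level_optimal_def)
      have "m' = m"
        using m(1) m'(1) outranked_trans outranked_irrefl unfolding top_rank_def by metis
      then have "t < x (active U (Suc j))"
        using m' True Suc.prems(1) by auto
      then have "t < active_argmax S U (Suc j + 1) i P"
        using \<open>x (active U (Suc j)) < xstar\<close> Suc.prems(2) by simp
      then show ?thesis
        using True t i Suc.prems(1) less_active_argmax_iff[of "Suc j" i t P] by simp
    next
      case False
      then show ?thesis
        using Suc.prems(3)[OF t m(1)] m(2) by simp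
    qed
    show ?thesis
    proof (rule Suc.IH[of "active_argmax S U (j + 1) i P"])
      show "result (scpc_while \<kappa> S U P x i j (active_argmax S U (j + 1) i P)) = (j', v)"
        using Suc.prems(4) True by (subst (asm) scpc_while.simps) simp
    qed (use Suc.prems(1) step in auto)
  qed
qed

text \<open>When the scan has stopped at \<open>j\<close>, at each level \<open>t\<close> index \<open>i\<close> is preferred to the old most preferred
  index if and only if it is preferred to \<open>j\<close>, that is, if and only if \<open>t < v\<close>. So the new value
  \<open>v\<close> on \<open>j + 1, \<dots>, i\<close> makes \<open>i\<close> the count exactly at the levels where it has become the most preferred
  index.\<close>

lemma level_optimal_extend:
  assumes x: "level_optimal P n x" and P: "0 \<le> P" and i: "i = n + 1" "i \<le> card U"
    and j: "j \<le> n" and v: "v = active_argmax S U (j + 1) i P"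
    and beaten: "\<And>t m. 0 \<le> t \<Longrightarrow> t < P \<Longrightarrow> top_rank t n m \<Longrightarrow> j < m \<Longrightarrow> outranked S U t m i"
    and stop: "j = 0 \<or> v \<le> x (active U j)"
    and x': "\<And>k. k \<le> card U \<Longrightarrow>
      x' (active U k) = (if j < k \<and> k \<le> i then v else x (active U k))"
  shows "level_optimal P i x'"
  unfolding level_optimal_def
proof (intro conjI allI impI ballI)
  fix k assume k: "k \<in> {1..i}"
  have "0 \<le> x' (active U k) \<and> x' (active U k) \<le> P"
  proof (cases "j < k")
    case True
    then show ?thesis
      using k i v P active_argmax_bounds x'[of k] by auto
  next
    case False
    then show ?thesis
      using k i j x x'[of k] by (auto simp: level_optimal_def)
  qed
  then show "0 \<le> x' (active U k)" "x' (active U k) \<le> P" by auto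
next
  fix t assume "0 \<le> t \<and> t < P"
  then have t: "0 \<le> t" "t < P" by auto
  obtain m where m: "top_rank t n m" "\<And>k. 1 \<le> k \<Longrightarrow> k \<le> n \<Longrightarrow> t < x (active U k) \<longleftrightarrow> k \<le> m"
    using x t unfolding level_optimal_def by (metis atLeastAtMost_iff)
  have v_iff: "t < v \<longleftrightarrow> outranked S U t j i"
    using less_active_argmax_iff[of j i t P] t i j v by simp
  have m_le: "m \<le> n" and m_top: "\<And>l. l \<le> n \<Longrightarrow> l \<noteq> m \<Longrightarrow> outranked S U t l m"
    using m(1) by (auto simp: top_rank_def)
  have j_i: "outranked S U t j i" if "outranked S U t m i"
    using that m_top[of j] j outranked_trans by metis
  have m_i: "outranked S U t m i" if "outranked S U t j i"
  proof -
    consider "j < m" | "m = j" | "m < j" by linarith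
    then show ?thesis
      \<comment> \<open>If \<open>m < j\<close>, then \<open>x\<^sub>j \<le> t < v\<close>, against the stopping condition.\<close>
    proof cases
      case 1
      then show ?thesis using beaten t m(1) by blast
    next
      case 2
      then show ?thesis using that by simp
    next
      case 3
      then have "t < x (active U j)"
        using v_iff that stop by auto
      then show ?thesis
        using m(2)[of j] 3 j by auto
    qed
  qed
  show "\<exists>m. top_rank t i m \<and> (\<forall>k\<in>{1..i}. t < x' (active U k) \<longleftrightarrow> k \<le> m)"
  proof (cases "outranked S U t m i")
    case True
    have "top_rank t i i"
      unfolding top_rank_def
    proof (intro conjI allI impI)
      fix l assume "l \<le> i" "l \<noteq> i"
      then show "outranked S U t l i"
        using True m_top[of l] outranked_trans i by (cases "l = m") auto
    qed simp
    moreover have "t < x' (active U k)" if k: "k \<in> {1..i}" for k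
    proof (cases "j < k")
      case True
      then show ?thesis
        using k i x'[of k] v_iff j_i \<open>outranked S U t m i\<close> by auto
    next
      case False
      then have "x (active U j) \<le> x (active U k)" "j \<noteq> 0"
        using level_optimal_antimono[OF x, of k j] k j by auto
      then show ?thesis
        using False k i x'[of k] v_iff j_i \<open>outranked S U t m i\<close> stop by auto
    qed
    ultimately show ?thesis by (intro exI[of _ i]) auto
  next
    case False
    have "top_rank t i m"
      unfolding top_rank_def
    proof (intro conjI allI impI)
      fix l assume "l \<le> i" "l \<noteq> m"
      then show "outranked S U t l m"
        using False m_top[of l] outranked_total[of m i] i m_le by (cases "l = i") auto
    qed (use m_le i in simp)
    moreover have "t < x' (active U k) \<longleftrightarrow> k \<le> m" if k: "k \<in> {1..i}" for k
    proof (cases "j < k")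
      case True
      have "\<not> j < m"
        using beaten t m(1) False by blast
      then show ?thesis
        using True k i x'[of k] v_iff m_i False by auto
    next
      case False
      then show ?thesis
        using k i j x'[of k] m(2)[of k] by auto
    qed
    ultimately show ?thesis by blast
  qed
qed

lemma level_optimal_scpc:
  assumes P: "0 \<le> P"
  shows "level_optimal P (card U) (result (scpc \<kappa> S U P))"
proof -
  define Inv where "Inv = (\<lambda>i x. level_optimal P (i - 1) x)"
  have "Inv (card U + 1) (result (scpc \<kappa> S U P))"
    unfolding scpc_def
  proof (rule for_loop_invariant[where Inv = Inv])
    show "Inv 1 (\<lambda>_. 0)"
      by (auto simp: Inv_def level_optimal_def top_rank_def)
  next
    fix i x assume i: "1 \<le> i" "i \<le> card U" and "Inv i x"
    then have x: "level_optimal P (i - 1) x"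
      by (simp add: Inv_def)
    obtain j v where jv:
      "result (scpc_while \<kappa> S U P x i (i - 1) (active_argmax S U i i P)) = (j, v)"
      by (metis surj_pair)
    have spec: "j \<le> i - 1 \<and> v = active_argmax S U (j + 1) i P \<and>
      (\<forall>t m. 0 \<le> t \<longrightarrow> t < P \<longrightarrow> top_rank t (i - 1) m \<longrightarrow> j < m \<longrightarrow> outranked S U t m i) \<and>
      (j = 0 \<or> v \<le> x (active U j))"
      by (rule scpc_while_spec[OF x _ _ _ _ _ jv]) (use i in \<open>auto simp: top_rank_def\<close>)
    have "level_optimal P i (result (for_loop (j + 1) i
        (\<lambda>k y. do { u \<leftarrow> basic (active U k); basic (y(u := v)) }) x))"
    proof (rule level_optimal_extend[OF x P, where j = j and v = v])
      fix k assume "k \<le> card U"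
      then show "result (for_loop (j + 1) i
          (\<lambda>k y. do { u \<leftarrow> basic (active U k); basic (y(u := v)) }) x) (active U k)
          = (if j < k \<and> k \<le> i then v else x (active U k))"
        using i spec finite_U zero_notin_U by (intro result_fill_loop) auto
    qed (use i spec in auto)
    then show "Inv (i + 1) (result (do {
          xstar \<leftarrow> eval_argmax \<kappa> S U i i P;
          j \<leftarrow> basic (i - 1);
          (j', xstar') \<leftarrow> scpc_while \<kappa> S U P x i j xstar;
          l \<leftarrow> basic (j' + 1);
          for_loop l i (\<lambda>k y. do { u \<leftarrow> basic (active U k); basic (y(u := xstar')) }) x
        }))"
      by (simp add: Inv_def jv[simplified])
  qed simp
  then show ?thesis by (simp add: Inv_def)
qed

section \<open>Optimality level by level\<close>

lemma rate_level_has_derivative: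
  assumes "k \<le> card U" "0 \<le> t"
  shows "(rate_level S U k has_real_derivative marginal S U k t) (at t within A)"
proof (cases "k = 0")
  case True
  then show ?thesis by (simp add: rate_level_def[abs_def] marginal_def)
next
  case False
  then have "0 < t + noise S (decode S (active U k))"
    using assms noise_pos[of k] by auto
  then show ?thesis
    using False unfolding rate_level_def[abs_def] marginal_def log_def
    by (auto intro!: derivative_eq_intros simp: divide_simps)
qed

lemma active_f_eq:
  assumes "1 \<le> k" "k \<le> card U"
  shows "active_f S U k k t = rate_level S U k t - rate_level S U (k - 1) t"
proof (cases "k = 1")
  case True
  then show ?thesis by (simp add: active_f_def rate_f_def rate_level_def)
next
  case False
  then have "0 < active U (k - 1)"
    using assms by (intro active_pos) auto
  then show ?thesis
    using False assms by (auto simp: active_f_def rate_f_def rate_level_def algebra_simps)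
qed

lemma active_f_integral:
  assumes k: "1 \<le> k" "k \<le> card U" and y: "0 \<le> y" "y \<le> P"
  shows "((\<lambda>t. if t < y then marginal S U k t - marginal S U (k - 1) t else 0) has_integral
    active_f S U k k y - active_f S U k k 0) {0..P}"
proof -
  have "((\<lambda>t. marginal S U k t - marginal S U (k - 1) t) has_integral
    (rate_level S U k y - rate_level S U (k - 1) y) -
    (rate_level S U k 0 - rate_level S U (k - 1) 0)) {0..y}"
  proof (rule fundamental_theorem_of_calculus[OF y(1)])
    fix t assume "t \<in> {0..y}"
    then show "((\<lambda>t. rate_level S U k t - rate_level S U (k - 1) t) has_vector_derivative
        marginal S U k t - marginal S U (k - 1) t) (at t within {0..y})"
      unfolding has_real_derivative_iff_has_vector_derivative[symmetric]
      using k by (intro DERIV_diff rate_level_has_derivative) auto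
  qed
  then have "((\<lambda>t. if t \<in> {0..y} then marginal S U k t - marginal S U (k - 1) t else 0)
    has_integral active_f S U k k y - active_f S U k k 0) {0..P}"
    using y k by (subst has_integral_restrict) (auto simp: active_f_eq)
  then show ?thesis
    by (rule has_integral_spike_finite[of "{y}", rotated 2]) auto
qed

lemma objective_integral:
  assumes "feasible U P y"
  shows "((\<lambda>t. \<Sum>k = 1..card U. if t < y (active U k)
      then marginal S U k t - marginal S U (k - 1) t else 0) has_integral
    objective S U B y - objective S U B (\<lambda>_. 0)) {0..P}"
proof -
  have "((\<lambda>t. \<Sum>k = 1..card U. if t < y (active U k)
      then marginal S U k t - marginal S U (k - 1) t else 0) has_integral
    (\<Sum>k = 1..card U. active_f S U k k (y (active U k)) - active_f S U k k 0)) {0..P}"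
    using assms by (intro has_integral_sum active_f_integral) (auto simp: feasible_iff)
  then show ?thesis
    by (simp add: objective_def sum_subtractf)
qed

lemma sum_marginal_prefix:
  assumes "m \<le> n" and "\<And>k. 1 \<le> k \<Longrightarrow> k \<le> n \<Longrightarrow> Q k \<longleftrightarrow> k \<le> m"
  shows "(\<Sum>k = 1..n. if Q k then marginal S U k t - marginal S U (k - 1) t else 0)
    = marginal S U m t"
proof -
  have "(\<Sum>k = 1..n. if Q k then marginal S U k t - marginal S U (k - 1) t else 0)
      = (\<Sum>k = 1..m. marginal S U k t - marginal S U (k - 1) t)"
    using assms by (intro sum.mono_neutral_cong_right) auto
  also have "\<dots> = marginal S U m t - marginal S U 0 t"
    by (induction m) auto
  finally show ?thesis
    by (simp add: marginal_def)
qed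

text \<open>For a nonincreasing vector, the entries above a level form a prefix.\<close>

lemma downward_closed_prefix:
  fixes n :: nat
  assumes "\<And>k l. 1 \<le> k \<Longrightarrow> k \<le> l \<Longrightarrow> l \<le> n \<Longrightarrow> Q l \<Longrightarrow> Q k"
  shows "\<exists>m\<le>n. \<forall>k. 1 \<le> k \<and> k \<le> n \<longrightarrow> (Q k \<longleftrightarrow> k \<le> m)"
  using assms
proof (induction n)
  case (Suc n)
  show ?case
  proof (cases "Q (Suc n)")
    case True
    then show ?thesis
      using Suc.prems by (intro exI[of _ "Suc n"]) auto
  next
    case False
    obtain m where "m \<le> n" "\<forall>k. 1 \<le> k \<and> k \<le> n \<longrightarrow> (Q k \<longleftrightarrow> k \<le> m)"
      using Suc.IH Suc.prems by (metis le_SucI)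
    then show ?thesis
      using False by (intro exI[of _ m]) (auto simp: le_Suc_eq)
  qed
qed simp

text \<open>Both objectives are integrals over \<open>[0, P]\<close>, compared pointwise. At a level \<open>t < P\<close> a feasible
  \<open>y\<close> contributes \<open>D\<^sub>l(t)\<close> for some \<open>l\<close>, and the truncation of \<open>x\<close> contributes the largest
  such value.\<close>

lemma optimal_control_truncation:
  assumes x: "level_optimal Pmax (card U) x" and P: "0 \<le> P" "P \<le> Pmax"
    and z: "\<And>k. 1 \<le> k \<Longrightarrow> k \<le> card U \<Longrightarrow> z (active U k) = min (x (active U k)) P"
  shows "optimal_control S U B P z"
proof -
  have feas: "feasible U P z"
    unfolding feasible_iff
  proof (intro conjI allI impI ballI)
    fix k l assume kl: "1 \<le> k \<and> k < l \<and> l \<le> card U"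
    then show "z (active U l) \<le> z (active U k)"
      using level_optimal_antimono[OF x, of k l] z[of k] z[of l] by auto
  qed (use x P z in \<open>auto simp: level_optimal_def\<close>)
  have "objective S U B y \<le> objective S U B z" if y: "feasible U P y" for y
  proof -
    have "objective S U B y - objective S U B (\<lambda>_. 0) \<le> objective S U B z - objective S U B (\<lambda>_. 0)"
    proof (rule has_integral_le[OF objective_integral[OF y] objective_integral[OF feas]])
      fix t assume t: "t \<in> {0..P}"
      show "(\<Sum>k = 1..card U. if t < y (active U k)
            then marginal S U k t - marginal S U (k - 1) t else 0)
          \<le> (\<Sum>k = 1..card U. if t < z (active U k)
            then marginal S U k t - marginal S U (k - 1) t else 0)"
        \<comment> \<open>At the level \<open>t = P\<close> both integrands vanish; it must be treated apart because for
          \<open>P = Pmax\<close> the invariant says nothing about it.\<close>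
      proof (cases "t = P")
        case True
        have "\<not> t < y (active U k)" "\<not> t < z (active U k)" if "k \<in> {1..card U}" for k
          using True y feas that by (auto simp: feasible_iff not_less)
        then show ?thesis by simp
      next
        case False
        then have "0 \<le> t" "t < Pmax" "t < P"
          using t P by auto
        then obtain m where m: "top_rank t (card U) m"
          "\<And>k. 1 \<le> k \<Longrightarrow> k \<le> card U \<Longrightarrow> t < x (active U k) \<longleftrightarrow> k \<le> m"
          using x unfolding level_optimal_def by (metis atLeastAtMost_iff)
        have "\<exists>l\<le>card U. \<forall>k. 1 \<le> k \<and> k \<le> card U \<longrightarrow> (t < y (active U k) \<longleftrightarrow> k \<le> l)"
        proof (rule downward_closed_prefix)
          fix k l assume kl: "1 \<le> k" "k \<le> l" "l \<le> card U" "t < y (active U l)"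
          have "y (active U l) \<le> y (active U k)"
            using y kl by (cases "k = l") (auto simp: feasible_iff)
          then show "t < y (active U k)"
            using kl by simp
        qed
        then obtain l where l: "l \<le> card U"
          "\<forall>k. 1 \<le> k \<and> k \<le> card U \<longrightarrow> (t < y (active U k) \<longleftrightarrow> k \<le> l)"
          by blast
        have "marginal S U l t \<le> marginal S U m t"
          using m(1) l(1) by (cases "l = m") (auto simp: top_rank_def outranked_def)
        moreover have "(\<Sum>k = 1..card U. if t < y (active U k)
            then marginal S U k t - marginal S U (k - 1) t else 0) = marginal S U l t"
          using l by (intro sum_marginal_prefix) auto
        moreover have "(\<Sum>k = 1..card U. if t < z (active U k)
            then marginal S U k t - marginal S U (k - 1) t else 0) = marginal S U m t"
          using m z \<open>t < P\<close> by (intro sum_marginal_prefix) (auto simp: top_rank_def)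
        ultimately show ?thesis by simp
      qed
    qed
    then show ?thesis by simp
  qed
  then show ?thesis
    using feas unfolding optimal_control_def is_arg_max_def by (meson not_less)
qed

lemma optimal_control_iscpc_all:
  assumes "0 \<le> Pmax" "1 \<le> r" "r \<le> C" "0 \<le> Ps r" "Ps r \<le> Pmax"
  shows "optimal_control S U B (Ps r) (result (iscpc_all \<kappa> S U Pmax C Ps) r)"
  by (rule optimal_control_truncation[OF level_optimal_scpc[OF assms(1), of \<kappa>]])
    (use assms finite_U zero_notin_U in
      \<open>auto simp: result_iscpc_all result_iscpc_eval iscpc_precompute_def\<close>)

end

section \<open>Complexity and optimality of the algorithm\<close>

theorem theorem4:
  fixes \<kappa> :: nat
  shows "\<exists>c1 c2 c3 :: nat. \<forall>(S :: subcarrier) (U :: nat set) (Pmax :: real).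
    valid_subcarrier S \<and> U \<subseteq> {1..num_users S} \<and> 0 \<le> Pmax \<longrightarrow>
      (U \<noteq> {} \<longrightarrow>
        cost (iscpc_precompute \<kappa> S U Pmax) \<le> c1 * (card U)^2) \<and>
      (U \<noteq> {} \<longrightarrow> (\<forall>P. 0 \<le> P \<and> P \<le> Pmax \<longrightarrow>
        cost (iscpc_eval U (result (iscpc_precompute \<kappa> S U Pmax)) P) \<le> c2 * card U)) \<and>
      (\<forall>(C :: nat) (Ps :: nat \<Rightarrow> real). (\<forall>r\<in>{1..C}. 0 \<le> Ps r \<and> Ps r \<le> Pmax) \<longrightarrow>
        (\<forall>B :: real. \<forall>r\<in>{1..C}.
          optimal_control S U B (Ps r) (result (iscpc_all \<kappa> S U Pmax C Ps) r)) \<and>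
        (U \<noteq> {} \<longrightarrow>
          cost (iscpc_all \<kappa> S U Pmax C Ps) \<le> c3 * ((card U)^2 + C * card U)))"
proof (rule exI[of _ "2 * \<kappa> + 19"], rule exI[of _ 7], rule exI[of _ "2 * \<kappa> + 20"],
    intro allI impI)
  fix S :: subcarrier and U :: "nat set" and Pmax :: real
  assume A: "valid_subcarrier S \<and> U \<subseteq> {1..num_users S} \<and> 0 \<le> Pmax"
  then interpret active_subcarrier S U
    by unfold_locales auto
  have "1 \<le> card U" if "U \<noteq> {}"
    using that finite_U by (simp add: Suc_le_eq card_gt_0_iff)
  then show "(U \<noteq> {} \<longrightarrow>
        cost (iscpc_precompute \<kappa> S U Pmax) \<le> (2 * \<kappa> + 19) * (card U)^2) \<and>
      (U \<noteq> {} \<longrightarrow> (\<forall>P. 0 \<le> P \<and> P \<le> Pmax \<longrightarrow>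
        cost (iscpc_eval U (result (iscpc_precompute \<kappa> S U Pmax)) P) \<le> 7 * card U)) \<and>
      (\<forall>(C :: nat) (Ps :: nat \<Rightarrow> real). (\<forall>r\<in>{1..C}. 0 \<le> Ps r \<and> Ps r \<le> Pmax) \<longrightarrow>
        (\<forall>B :: real. \<forall>r\<in>{1..C}.
          optimal_control S U B (Ps r) (result (iscpc_all \<kappa> S U Pmax C Ps) r)) \<and>
        (U \<noteq> {} \<longrightarrow>
          cost (iscpc_all \<kappa> S U Pmax C Ps) \<le> (2 * \<kappa> + 20) * ((card U)^2 + C * card U)))"
    using A cost_iscpc_precompute_le cost_iscpc_eval_le cost_iscpc_all_le
    by (auto intro!: optimal_control_iscpc_all)
qed

end
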